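(* The categories $\mathcal{A}_2$ and $\mathcal{A}_3$ are isomorphic to the categories $\mathcal{D}_2$ and $\mathcal{D}_3$, respectively (all four categories are defined in the context).
   Context: A left quasigroup $(L,\cdot)$ is a nonempty set $L$ with a binary operation such that for all $u,w\in L$ there is a unique $v\in L$ with $u\cdot v=w$; this $v$ is denoted $u\backslash_L w$, and $uv$ means $u\cdot v$. Homomorphisms of left quasigroups are maps $f$ with $f(uv)=f(u)f(v)$. A ternary system $(M,\mu)$ is a nonempty set $M$ with a map $\mu:M^3\to M$; a homomorphism $h:(M,\mu)\to(M',\mu')$ is a map with $h(\mu(a,b,c))=\mu'(h(a),h(b),h(c))$ for all $a,b,c$. Category $\mathcal{A}$. Let $LMB$ be the collection of all triplets $(L,M,\pi)$ where $L$ is a left quasigroup, $M=(M,\mu)$ is a ternary system satisfying, for all $a,b,c,d\in M$, $$\mu(a,\mu(a,b,c),\mu(\mu(a,b,c),c,d))=\mu(a,b,\mu(b,c,d)),$$ $$\mu(\mu(a,b,c),c,d)=\mu(\mu(a,b,\mu(b,c,d)),\mu(b,c,d),d),$$ and $\pi:L\to M$ is a bijection. Write $(L,M,\pi)\sim(L',M',\pi')$ iff $L=L'$ as left quasigroups and $\pi'\pi^{-1}:M\to M'$ is a homomorphism of ternary systems (an equivalence relation). Objects of $\mathcal{A}$ are the equivalence classes $[(L,M,\pi)]$; $L_V$ denotes the common left quasigroup of all representatives of $V$. A morphism $f:V\to V'$ is a homomorphism $f:L_V\to L_{V'}$ of left quasigroups such that $\pi'f\pi^{-1}:M\to M'$ is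 a homomorphism of ternary systems for all representatives $(L_V,M,\pi)\in V$, $(L_{V'},M',\pi')\in V'$. Identities and composition are those of maps. Dynamical Yang-Baxter maps. Let $H,X$ be nonempty sets and $\phi:H\times X\to H$. A family $R(\lambda):X\times X\to X\times X$ ($\lambda\in H$) is a dynamical Yang-Baxter map associated with $H,X,\phi$ iff for every $\lambda\in H$, on $X^3$, $$R_{23}(\lambda)R_{13}(\phi(\lambda,X^{(2)}))R_{12}(\lambda)=R_{12}(\phi(\lambda,X^{(3)}))R_{13}(\lambda)R_{23}(\phi(\lambda,X^{(1)})),$$ where $R_{ij}(\lambda)$ applies $R(\lambda)$ to the $i$-th and $j$-th components and fixes the other, and $R_{ij}(\phi(\lambda,X^{(k)}))(u_1,u_2,u_3)=R_{ij}(\phi(\lambda,u_k))(u_1,u_2,u_3)$ with $\{i,j,k\}=\{1,2,3\}$. Category $\mathcal{D}$. Objects are pairs $(L,R(\lambda))$ where $L=(L,\cdot)$ is a left quasigroup and $R(\lambda)$ ($\lambda\in L$) is a dynamical Yang-Baxter map associated with $L,L,(\cdot)$ such that, writing $R(\lambda)(u,v)=(\eta_\lambda(v)(u),\xi_\lambda(u)(v))$, one has $(\lambda\,\xi_\lambda(u)(v))\,\eta_\lambda(v)(u)=(\lambda u)v$ for all $\lambda,u,v\in L$. A morphism $f:(L,R(\lambda))\to(L',R'(\lambda'))$ is a homomorphism $f:L\to L'$ of left quasigroups with $R'(f(\lambda))(f\times f)=(f\times f)R(\lambda)$ for all $\lambda\in L$. Identities and composition are those of maps. $\mathcal{A}_2$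 (resp. $\mathcal{A}_3$) is the full subcategory of $\mathcal{A}$ whose objects are the $V$ having a representative $(L,(M,\mu),\pi)$ such that for all $a,b,c,d\in M$: for $\mathcal{A}_2$: $\mu(\mu(a,b,c),c,d)=\mu(a,b,d)$ and $\mu(a,b,b)=a$; for $\mathcal{A}_3$: $\mu(a,b,c)=\mu(d,b,\mu(a,d,c))$ and $\mu(a,a,b)=b$. $\mathcal{D}_2$ is the full subcategory of $\mathcal{D}$ whose objects are the $(L,R(\lambda))$ such that for all $\lambda,u,v,w\in L$ $$(\lambda\xi_\lambda(u)(v))\,\xi_{\lambda\xi_\lambda(u)(v)}(\eta_\lambda(v)(u))(w)=\lambda\,\xi_\lambda(u)\bigl((\lambda u)\backslash_L(((\lambda u)v)w)\bigr),$$ $$\xi_\lambda(u)((\lambda u)\backslash_L(\lambda u))=\lambda\backslash_L\lambda.$$ $\mathcal{D}_3$ is the full subcategory of $\mathcal{D}$ whose objects are the $(L,R(\lambda))$ such that for all $\lambda,u,v,w\in L$ $$\lambda\,\xi_\lambda(v)\bigl((\lambda v)\backslash_L((\lambda u)\,\xi_{\lambda u}((\lambda u)\backslash_L\lambda)(w))\bigr)=(\lambda u)\,\xi_{\lambda u}((\lambda u)\backslash_L(\lambda v))((\lambda v)\backslash_L(\lambda w)),$$ $$\xi_\lambda(\lambda\backslash_L\lambda)=\mathrm{id}_L.$$ *)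

theory Defs
  imports "HOL-Library.FuncSet"
begin

text \<open>
  Every set occurring in an object is a subset of one type \<^typ>\<open>'a\<close>, which plays the role of the
  universe of sets. All maps (operations, ternary products, bijections, the maps \<open>R(\<lambda>)\<close>, morphisms)
  are extensional: they are \<^const>\<open>undefined\<close> outside their domain, so equality in HOL is equality of
  maps on that domain. This matters because isomorphism of categories refers to equality of objects.
\<close>

record ('o, 'm) cat =
  Obj :: "'o set"
  Hom :: "'o \<Rightarrow> 'o \<Rightarrow> 'm set"
  Id :: "'o \<Rightarrow> 'm"
  Comp :: "'o \<Rightarrow> 'o \<Rightarrow> 'o \<Rightarrow> 'm \<Rightarrow> 'm \<Rightarrow> 'm"

text \<open>\<open>Comp C U V W g f\<close> is the composite of \<open>f : U \<rightarrow> V\<close> and \<open>g : V \<rightarrow> W\<close>. The hom-sets need not be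
  disjoint; all operations on morphisms take the objects involved as arguments.\<close>

definition category :: "('o, 'm) cat \<Rightarrow> bool" where
  "category C \<longleftrightarrow>
     (\<forall>U\<in>Obj C. Id C U \<in> Hom C U U) \<and>
     (\<forall>U\<in>Obj C. \<forall>V\<in>Obj C. \<forall>W\<in>Obj C. \<forall>f\<in>Hom C U V. \<forall>g\<in>Hom C V W.
        Comp C U V W g f \<in> Hom C U W) \<and>
     (\<forall>U\<in>Obj C. \<forall>V\<in>Obj C. \<forall>f\<in>Hom C U V.
        Comp C U U V f (Id C U) = f \<and> Comp C U V V (Id C V) f = f) \<and>
     (\<forall>T\<in>Obj C. \<forall>U\<in>Obj C. \<forall>V\<in>Obj C. \<forall>W\<in>Obj C.
        \<forall>f\<in>Hom C T U. \<forall>g\<in>Hom C U V. \<forall>h\<in>Hom C V W.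
        Comp C T U W (Comp C U V W h g) f = Comp C T V W h (Comp C T U V g f))"

definition is_functor ::
  "('o, 'm) cat \<Rightarrow> ('p, 'n) cat \<Rightarrow> ('o \<Rightarrow> 'p) \<Rightarrow> ('o \<Rightarrow> 'o \<Rightarrow> 'm \<Rightarrow> 'n) \<Rightarrow> bool" where
  "is_functor C D F\<^sub>0 F\<^sub>1 \<longleftrightarrow>
     (\<forall>U\<in>Obj C. F\<^sub>0 U \<in> Obj D) \<and>
     (\<forall>U\<in>Obj C. \<forall>V\<in>Obj C. \<forall>f\<in>Hom C U V. F\<^sub>1 U V f \<in> Hom D (F\<^sub>0 U) (F\<^sub>0 V)) \<and>
     (\<forall>U\<in>Obj C. F\<^sub>1 U U (Id C U) = Id D (F\<^sub>0 U)) \<and>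
     (\<forall>U\<in>Obj C. \<forall>V\<in>Obj C. \<forall>W\<in>Obj C. \<forall>f\<in>Hom C U V. \<forall>g\<in>Hom C V W.
        F\<^sub>1 U W (Comp C U V W g f) = Comp D (F\<^sub>0 U) (F\<^sub>0 V) (F\<^sub>0 W) (F\<^sub>1 V W g) (F\<^sub>1 U V f))"

definition isomorphic_categories :: "('o, 'm) cat \<Rightarrow> ('p, 'n) cat \<Rightarrow> bool" where
  "isomorphic_categories C D \<longleftrightarrow> category C \<and> category D \<and>
     (\<exists>F\<^sub>0 F\<^sub>1 G\<^sub>0 G\<^sub>1. is_functor C D F\<^sub>0 F\<^sub>1 \<and> is_functor D C G\<^sub>0 G\<^sub>1 \<and>
        (\<forall>U\<in>Obj C. G\<^sub>0 (F\<^sub>0 U) = U) \<and>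
        (\<forall>U\<in>Obj C. \<forall>V\<in>Obj C. \<forall>f\<in>Hom C U V. G\<^sub>1 (F\<^sub>0 U) (F\<^sub>0 V) (F\<^sub>1 U V f) = f) \<and>
        (\<forall>U\<in>Obj D. F\<^sub>0 (G\<^sub>0 U) = U) \<and>
        (\<forall>U\<in>Obj D. \<forall>V\<in>Obj D. \<forall>f\<in>Hom D U V. F\<^sub>1 (G\<^sub>0 U) (G\<^sub>0 V) (G\<^sub>1 U V f) = f))"

definition full_subcategory :: "('o, 'm) cat \<Rightarrow> ('o \<Rightarrow> bool) \<Rightarrow> ('o, 'm) cat" where
  "full_subcategory C P = C\<lparr>Obj := {U \<in> Obj C. P U}\<rparr>"

record 'a left_qg =
  carrier :: "'a set"
  mult :: "'a \<Rightarrow> 'a \<Rightarrow> 'a"  (infixl "\<cdot>\<index>" 70)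

definition left_quasigroup :: "'a left_qg \<Rightarrow> bool" where
  "left_quasigroup L \<longleftrightarrow> carrier L \<noteq> {} \<and>
     mult L \<in> carrier L \<rightarrow>\<^sub>E carrier L \<rightarrow>\<^sub>E carrier L \<and>
     (\<forall>u\<in>carrier L. \<forall>w\<in>carrier L. \<exists>!v. v \<in> carrier L \<and> u \<cdot>\<^bsub>L\<^esub> v = w)"

definition ldiv :: "'a left_qg \<Rightarrow> 'a \<Rightarrow> 'a \<Rightarrow> 'a" where
  "ldiv L u w = (THE v. v \<in> carrier L \<and> u \<cdot>\<^bsub>L\<^esub> v = w)"

definition lq_hom :: "'a left_qg \<Rightarrow> 'a left_qg \<Rightarrow> ('a \<Rightarrow> 'a) set" where
  "lq_hom L L' = {f \<in> carrier L \<rightarrow>\<^sub>E carrier L'.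
     \<forall>u\<in>carrier L. \<forall>v\<in>carrier L. f (u \<cdot>\<^bsub>L\<^esub> v) = f u \<cdot>\<^bsub>L'\<^esub> f v}"

record 'a ternary =
  tcarrier :: "'a set"
  tern :: "'a \<Rightarrow> 'a \<Rightarrow> 'a \<Rightarrow> 'a"

definition ternary_system :: "'a ternary \<Rightarrow> bool" where
  "ternary_system M \<longleftrightarrow> tcarrier M \<noteq> {} \<and>
     tern M \<in> tcarrier M \<rightarrow>\<^sub>E tcarrier M \<rightarrow>\<^sub>E tcarrier M \<rightarrow>\<^sub>E tcarrier M"

definition ternary_hom :: "'a ternary \<Rightarrow> 'a ternary \<Rightarrow> ('a \<Rightarrow> 'a) \<Rightarrow> bool" where
  "ternary_hom M M' h \<longleftrightarrow> h \<in> tcarrier M \<rightarrow> tcarrier M' \<and>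
     (\<forall>a\<in>tcarrier M. \<forall>b\<in>tcarrier M. \<forall>c\<in>tcarrier M.
        h (tern M a b c) = tern M' (h a) (h b) (h c))"

type_synonym 'a triplet = "'a left_qg \<times> 'a ternary \<times> ('a \<Rightarrow> 'a)"

definition LMB :: "'a triplet set" where
  "LMB = {(L, M, \<pi>). left_quasigroup L \<and> ternary_system M \<and>
     (\<forall>a\<in>tcarrier M. \<forall>b\<in>tcarrier M. \<forall>c\<in>tcarrier M. \<forall>d\<in>tcarrier M.
        tern M a (tern M a b c) (tern M (tern M a b c) c d) = tern M a b (tern M b c d) \<and>
        tern M (tern M a b c) c d
          = tern M (tern M a b (tern M b c d)) (tern M b c d) d) \<and>
     \<pi> \<in> extensional (carrier L) \<and> bij_betw \<pi> (carrier L) (tcarrier M)}"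

definition LMB_rel :: "'a triplet rel" where
  "LMB_rel = {((L, M, \<pi>), (L', M', \<pi>')).
     (L, M, \<pi>) \<in> LMB \<and> (L', M', \<pi>') \<in> LMB \<and> L = L' \<and>
     ternary_hom M M' (\<pi>' \<circ> inv_into (carrier L) \<pi>)}"

definition lq_of :: "'a triplet set \<Rightarrow> 'a left_qg" where
  "lq_of V = (THE L. \<exists>M \<pi>. (L, M, \<pi>) \<in> V)"

definition cat_A :: "('a triplet set, 'a \<Rightarrow> 'a) cat" where
  "cat_A = \<lparr>
     Obj = LMB // LMB_rel,
     Hom = (\<lambda>V V'. {f \<in> lq_hom (lq_of V) (lq_of V').
       \<forall>M \<pi> M' \<pi>'. (lq_of V, M, \<pi>) \<in> V \<longrightarrow> (lq_of V', M', \<pi>') \<in> V' \<longrightarrow>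
         ternary_hom M M' (\<pi>' \<circ> f \<circ> inv_into (carrier (lq_of V)) \<pi>)}),
     Id = (\<lambda>V. restrict id (carrier (lq_of V))),
     Comp = (\<lambda>U V W g f. compose (carrier (lq_of U)) g f)\<rparr>"

definition cat_A2 :: "('a triplet set, 'a \<Rightarrow> 'a) cat" where
  "cat_A2 = full_subcategory cat_A (\<lambda>V. \<exists>L M \<pi>. (L, M, \<pi>) \<in> V \<and>
     (\<forall>a\<in>tcarrier M. \<forall>b\<in>tcarrier M. \<forall>c\<in>tcarrier M. \<forall>d\<in>tcarrier M.
        tern M (tern M a b c) c d = tern M a b d \<and> tern M a b b = a))"

definition cat_A3 :: "('a triplet set, 'a \<Rightarrow> 'a) cat" where
  "cat_A3 = full_subcategory cat_A (\<lambda>V. \<exists>L M \<pi>. (L, M, \<pi>) \<in> V \<and>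
     (\<forall>a\<in>tcarrier M. \<forall>b\<in>tcarrier M. \<forall>c\<in>tcarrier M. \<forall>d\<in>tcarrier M.
        tern M a b c = tern M d b (tern M a d c) \<and> tern M a a b = b))"

fun on12 on13 on23 :: "('x \<times> 'x \<Rightarrow> 'x \<times> 'x) \<Rightarrow> 'x \<times> 'x \<times> 'x \<Rightarrow> 'x \<times> 'x \<times> 'x" where
  "on12 r (u1, u2, u3) = (fst (r (u1, u2)), snd (r (u1, u2)), u3)"
| "on13 r (u1, u2, u3) = (fst (r (u1, u3)), u2, snd (r (u1, u3)))"
| "on23 r (u1, u2, u3) = (u1, fst (r (u2, u3)), snd (r (u2, u3)))"

definition dynamical_YB_map ::
  "'h set \<Rightarrow> 'x set \<Rightarrow> ('h \<Rightarrow> 'x \<Rightarrow> 'h) \<Rightarrow> ('h \<Rightarrow> 'x \<times> 'x \<Rightarrow> 'x \<times> 'x) \<Rightarrow> bool" where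
  "dynamical_YB_map H X \<phi> R \<longleftrightarrow> H \<noteq> {} \<and> X \<noteq> {} \<and> \<phi> \<in> H \<rightarrow> X \<rightarrow> H \<and>
     R \<in> H \<rightarrow> X \<times> X \<rightarrow> X \<times> X \<and>
     (\<forall>l\<in>H. \<forall>u\<in>X \<times> X \<times> X.
        (on23 (R l) \<circ> (\<lambda>(u1, u2, u3). on13 (R (\<phi> l u2)) (u1, u2, u3)) \<circ> on12 (R l)) u =
        ((\<lambda>(u1, u2, u3). on12 (R (\<phi> l u3)) (u1, u2, u3)) \<circ> on13 (R l) \<circ>
           (\<lambda>(u1, u2, u3). on23 (R (\<phi> l u1)) (u1, u2, u3))) u)"

type_synonym 'a dyn = "'a left_qg \<times> ('a \<Rightarrow> 'a \<times> 'a \<Rightarrow> 'a \<times> 'a)"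

text \<open>\<open>R(\<lambda>)(u, v) = (\<eta>\<^sub>\<lambda>(v)(u), \<xi>\<^sub>\<lambda>(u)(v))\<close>; note the order of the arguments of \<open>\<eta>\<close>.\<close>

definition eta :: "('a \<Rightarrow> 'a \<times> 'a \<Rightarrow> 'a \<times> 'a) \<Rightarrow> 'a \<Rightarrow> 'a \<Rightarrow> 'a \<Rightarrow> 'a" where
  "eta R l v u = fst (R l (u, v))"

definition xi :: "('a \<Rightarrow> 'a \<times> 'a \<Rightarrow> 'a \<times> 'a) \<Rightarrow> 'a \<Rightarrow> 'a \<Rightarrow> 'a \<Rightarrow> 'a" where
  "xi R l u v = snd (R l (u, v))"

definition cat_D :: "('a dyn, 'a \<Rightarrow> 'a) cat" where
  "cat_D = \<lparr>
     Obj = {(L, R). left_quasigroup L \<and>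
       R \<in> carrier L \<rightarrow>\<^sub>E carrier L \<times> carrier L \<rightarrow>\<^sub>E carrier L \<times> carrier L \<and>
       dynamical_YB_map (carrier L) (carrier L) (mult L) R \<and>
       (\<forall>l\<in>carrier L. \<forall>u\<in>carrier L. \<forall>v\<in>carrier L.
          (l \<cdot>\<^bsub>L\<^esub> xi R l u v) \<cdot>\<^bsub>L\<^esub> eta R l v u = (l \<cdot>\<^bsub>L\<^esub> u) \<cdot>\<^bsub>L\<^esub> v)},
     Hom = (\<lambda>(L, R) (L', R'). {f \<in> lq_hom L L'.
       \<forall>l\<in>carrier L. \<forall>p\<in>carrier L \<times> carrier L.
         R' (f l) (map_prod f f p) = map_prod f f (R l p)}),
     Id = (\<lambda>(L, R). restrict id (carrier L)),
     Comp = (\<lambda>(L, R) V W g f. compose (carrier L) g f)\<rparr>"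

definition cat_D2 :: "('a dyn, 'a \<Rightarrow> 'a) cat" where
  "cat_D2 = full_subcategory cat_D (\<lambda>(L, R).
     \<forall>l\<in>carrier L. \<forall>u\<in>carrier L. \<forall>v\<in>carrier L. \<forall>w\<in>carrier L.
       (l \<cdot>\<^bsub>L\<^esub> xi R l u v) \<cdot>\<^bsub>L\<^esub> xi R (l \<cdot>\<^bsub>L\<^esub> xi R l u v) (eta R l v u) w
         = l \<cdot>\<^bsub>L\<^esub> xi R l u (ldiv L (l \<cdot>\<^bsub>L\<^esub> u) (((l \<cdot>\<^bsub>L\<^esub> u) \<cdot>\<^bsub>L\<^esub> v) \<cdot>\<^bsub>L\<^esub> w)) \<and>
       xi R l u (ldiv L (l \<cdot>\<^bsub>L\<^esub> u) (l \<cdot>\<^bsub>L\<^esub> u)) = ldiv L l l)"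

definition cat_D3 :: "('a dyn, 'a \<Rightarrow> 'a) cat" where
  "cat_D3 = full_subcategory cat_D (\<lambda>(L, R).
     \<forall>l\<in>carrier L. \<forall>u\<in>carrier L. \<forall>v\<in>carrier L. \<forall>w\<in>carrier L.
       l \<cdot>\<^bsub>L\<^esub> xi R l v (ldiv L (l \<cdot>\<^bsub>L\<^esub> v)
           ((l \<cdot>\<^bsub>L\<^esub> u) \<cdot>\<^bsub>L\<^esub> xi R (l \<cdot>\<^bsub>L\<^esub> u) (ldiv L (l \<cdot>\<^bsub>L\<^esub> u) l) w))
         = (l \<cdot>\<^bsub>L\<^esub> u) \<cdot>\<^bsub>L\<^esub> xi R (l \<cdot>\<^bsub>L\<^esub> u) (ldiv L (l \<cdot>\<^bsub>L\<^esub> u) (l \<cdot>\<^bsub>L\<^esub> v))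
             (ldiv L (l \<cdot>\<^bsub>L\<^esub> v) (l \<cdot>\<^bsub>L\<^esub> w)) \<and>
       xi R l (ldiv L l l) w = w)"

end

theory Submission
  imports Defs
begin

text \<open>
  Both sides describe the same data, a left quasigroup \<open>L\<close> together with one ternary operation \<open>m\<close> on
  the set \<open>L\<close> itself, and they describe it in different coordinates.

  On the side of the triplets, the bijection \<open>\<pi>\<close> pulls \<open>\<mu>\<close> back to \<open>m\<close>, and two triplets are
  equivalent exactly when they have the same \<open>L\<close> and the same \<open>m\<close> (\<open>LMB_rel_iff\<close>). So a class is the
  set of all triplets over one pair \<open>(L, m)\<close>.

  On the side of the Yang-Baxter maps, \<open>R(\<lambda>)\<close> acts on pairs \<open>(u, v)\<close>, and such a pair is the same as a
  path \<open>a, b, c\<close> in \<open>L\<close> with \<open>a = \<lambda>\<close>, \<open>b = \<lambda>u\<close> and \<open>c = (\<lambda>u)v\<close>: because left translations are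
  bijective, each step is the left quotient of its endpoints. The condition
  \<open>(\<lambda> \<xi>\<^sub>\<lambda>(u)(v)) \<eta>\<^sub>\<lambda>(v)(u) = (\<lambda>u)v\<close> says that \<open>R\<close> keeps both endpoints of the path, so that \<open>R\<close> only replaces
  the middle vertex \<open>b\<close> by some \<open>m a b c\<close>; the two new steps come out in the opposite order, the first
  one being the value of \<open>\<xi>\<close>. Hence \<open>R\<close> and \<open>m\<close> determine each other.

  The dynamical parameter always equals the vertex at which the affected pair of steps begins. Both
  sides of the Yang-Baxter equation therefore move the two inner vertices of a path \<open>a, b, c, d\<close>:
  one side moves the first, then the second, then the first vertex, the other side the second, the
  first and the second. Equality of the resulting inner vertices is literally the pair of ternary
  identities required of \<open>M\<close> (\<open>dyn_of_yang_baxter\<close>). The additional axioms of the two pairs of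
  subcategories also turn into each other once they are written in terms of vertices
  (\<open>dyn_of_identities2\<close>, \<open>dyn_of_identities3\<close>), and a homomorphism of left quasigroups
  commutes with \<open>R\<close> iff it commutes with \<open>m\<close> (\<open>dyn_of_hom_iff\<close>).

  So both categories arise from the category of pairs \<open>(L, m)\<close> by renaming objects, with the same maps
  as morphisms, and the additional axioms cut out corresponding full subcategories.
\<close>

section \<open>Relabelling the objects of a category\<close>

text \<open>
  The special case of an isomorphism of categories that is the identity on morphisms. It suffices
  here because all morphisms in question are maps between the same left quasigroups.
\<close>

definition relabels :: "('o \<Rightarrow> 'p) \<Rightarrow> ('o, 'm) cat \<Rightarrow> ('p, 'm) cat \<Rightarrow> bool" where
  "relabels \<phi> C D \<longleftrightarrow> bij_betw \<phi> (Obj C) (Obj D) \<and>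
     (\<forall>U\<in>Obj C. \<forall>V\<in>Obj C. Hom D (\<phi> U) (\<phi> V) = Hom C U V) \<and>
     (\<forall>U\<in>Obj C. Id D (\<phi> U) = Id C U) \<and>
     (\<forall>U\<in>Obj C. \<forall>V\<in>Obj C. \<forall>W\<in>Obj C. \<forall>f\<in>Hom C U V. \<forall>g\<in>Hom C V W.
        Comp D (\<phi> U) (\<phi> V) (\<phi> W) g f = Comp C U V W g f)"

lemma relabels_category:
  assumes "category C" "relabels \<phi> C D"
  shows "category D"
proof -
  have D: "Obj D = \<phi> ` Obj C"
    using assms(2) by (auto simp: relabels_def bij_betw_def)
  show ?thesis
    using assms unfolding category_def D relabels_def by simp
qed

lemma relabels_inv:
  assumes "relabels \<phi> C D"
  shows "relabels (inv_into (Obj C) \<phi>) D C"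
proof -
  have bij: "bij_betw \<phi> (Obj C) (Obj D)"
    using assms by (simp add: relabels_def)
  have inv: "inv_into (Obj C) \<phi> (\<phi> U) = U" if "U \<in> Obj C" for U
    using bij that by (simp add: bij_betw_inv_into_left)
  have D: "Obj D = \<phi> ` Obj C"
    using bij by (auto simp: bij_betw_def)
  show ?thesis
    using assms bij_betw_inv_into[OF bij] unfolding relabels_def D by (simp add: inv)
qed

lemma relabels_trans:
  assumes "relabels \<phi> C D" "relabels \<psi> D E"
  shows "relabels (\<psi> \<circ> \<phi>) C E"
proof -
  have in_D: "\<phi> U \<in> Obj D" if "U \<in> Obj C" for U
    using assms(1) that by (auto simp: relabels_def bij_betw_def)
  have "bij_betw (\<psi> \<circ> \<phi>) (Obj C) (Obj E)"
    using assms by (auto simp: relabels_def intro: bij_betw_trans)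
  with assms show ?thesis
    by (simp add: relabels_def in_D)
qed

lemma relabels_isomorphic:
  assumes "category C" "relabels \<phi> C D"
  shows "isomorphic_categories C D"
proof -
  let ?\<psi> = "inv_into (Obj C) \<phi>"
  have is_fun: "is_functor X Y \<chi> (\<lambda>_ _ f. f)" if "relabels \<chi> X Y"
    for \<chi> and X :: "('x, 'm) cat" and Y :: "('y, 'm) cat"
    using that by (auto simp: relabels_def is_functor_def bij_betw_def)
  have bij: "bij_betw \<phi> (Obj C) (Obj D)"
    using assms by (simp add: relabels_def)
  show ?thesis
    unfolding isomorphic_categories_def
    using assms(1) relabels_category[OF assms] is_fun[OF assms(2)]
      is_fun[OF relabels_inv[OF assms(2)]]
      bij_betw_inv_into_left[OF bij] bij_betw_inv_into_right[OF bij]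
    by (intro conjI exI[of _ \<phi>] exI[of _ "\<lambda>_ _ f. f"] exI[of _ ?\<psi>]) simp_all
qed

lemma relabels_full_subcategory:
  assumes "relabels \<phi> C D" "\<And>U. U \<in> Obj C \<Longrightarrow> P U \<longleftrightarrow> Q (\<phi> U)"
  shows "relabels \<phi> (full_subcategory C P) (full_subcategory D Q)"
proof -
  have bij: "bij_betw \<phi> (Obj C) (Obj D)"
    using assms by (simp add: relabels_def)
  have D: "Obj D = \<phi> ` Obj C"
    using bij by (auto simp: bij_betw_def)
  have "bij_betw \<phi> {U \<in> Obj C. P U} {V \<in> Obj D. Q V}"
    using bij assms(2) unfolding D by (auto simp: bij_betw_def inj_on_def)
  with assms(1) show ?thesis
    by (simp add: relabels_def full_subcategory_def)
qed

lemma category_full_subcategory: "category C \<Longrightarrow> category (full_subcategory C P)"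
  by (simp add: category_def full_subcategory_def)

section \<open>Left quasigroups with a ternary operation on the same set\<close>

definition ternary_ops :: "'a set \<Rightarrow> ('a \<Rightarrow> 'a \<Rightarrow> 'a \<Rightarrow> 'a) set" where
  "ternary_ops T = T \<rightarrow>\<^sub>E T \<rightarrow>\<^sub>E T \<rightarrow>\<^sub>E T"

definition yb_identities :: "'a set \<Rightarrow> ('a \<Rightarrow> 'a \<Rightarrow> 'a \<Rightarrow> 'a) \<Rightarrow> bool" where
  "yb_identities T m \<longleftrightarrow> (\<forall>a\<in>T. \<forall>b\<in>T. \<forall>c\<in>T. \<forall>d\<in>T.
     m a (m a b c) (m (m a b c) c d) = m a b (m b c d) \<and>
     m (m a b c) c d = m (m a b (m b c d)) (m b c d) d)"

definition identities2 :: "'a set \<Rightarrow> ('a \<Rightarrow> 'a \<Rightarrow> 'a \<Rightarrow> 'a) \<Rightarrow> bool" where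
  "identities2 T m \<longleftrightarrow> (\<forall>a\<in>T. \<forall>b\<in>T. \<forall>c\<in>T. \<forall>d\<in>T.
     m (m a b c) c d = m a b d \<and> m a b b = a)"

definition identities3 :: "'a set \<Rightarrow> ('a \<Rightarrow> 'a \<Rightarrow> 'a \<Rightarrow> 'a) \<Rightarrow> bool" where
  "identities3 T m \<longleftrightarrow> (\<forall>a\<in>T. \<forall>b\<in>T. \<forall>c\<in>T. \<forall>d\<in>T.
     m a b c = m d b (m a d c) \<and> m a a b = b)"

text \<open>The category of pairs \<open>(L, m)\<close> to which both sides are compared.\<close>

definition cat_T :: "('a left_qg \<times> ('a \<Rightarrow> 'a \<Rightarrow> 'a \<Rightarrow> 'a), 'a \<Rightarrow> 'a) cat" where
  "cat_T = \<lparr>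
     Obj = {(L, m). left_quasigroup L \<and> m \<in> ternary_ops (carrier L) \<and>
       yb_identities (carrier L) m},
     Hom = (\<lambda>(L, m) (L', m'). {f \<in> lq_hom L L'.
       \<forall>a\<in>carrier L. \<forall>b\<in>carrier L. \<forall>c\<in>carrier L. f (m a b c) = m' (f a) (f b) (f c)}),
     Id = (\<lambda>(L, m). restrict id (carrier L)),
     Comp = (\<lambda>(L, m) V W g f. compose (carrier L) g f)\<rparr>"

lemma ternary_ops_closed [simp]:
  "m \<in> ternary_ops T \<Longrightarrow> a \<in> T \<Longrightarrow> b \<in> T \<Longrightarrow> c \<in> T \<Longrightarrow> m a b c \<in> T"
  unfolding ternary_ops_def by (drule (1) PiE_mem)+

lemma ternary_ops_ext:
  assumes m: "m \<in> ternary_ops T" and n: "n \<in> ternary_ops T"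
    and eq: "\<And>a b c. a \<in> T \<Longrightarrow> b \<in> T \<Longrightarrow> c \<in> T \<Longrightarrow> m a b c = n a b c"
  shows "m = n"
proof (rule PiE_ext[OF m[unfolded ternary_ops_def] n[unfolded ternary_ops_def]])
  fix a assume a: "a \<in> T"
  note maps = PiE_mem[OF m[unfolded ternary_ops_def] a] PiE_mem[OF n[unfolded ternary_ops_def] a]
  show "m a = n a"
  proof (rule PiE_ext[OF maps])
    fix b assume b: "b \<in> T"
    show "m a b = n a b"
      by (rule PiE_ext[OF PiE_mem[OF maps(1) b] PiE_mem[OF maps(2) b]]) (rule eq[OF a b])
  qed
qed

lemma restrict_in_ternary_ops [simp]:
  "(\<And>a b c. a \<in> T \<Longrightarrow> b \<in> T \<Longrightarrow> c \<in> T \<Longrightarrow> m a b c \<in> T) \<Longrightarrow>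
   (\<lambda>a\<in>T. \<lambda>b\<in>T. \<lambda>c\<in>T. m a b c) \<in> ternary_ops T"
  by (simp add: ternary_ops_def)

lemma lq_hom_maps: "f \<in> lq_hom L L' \<Longrightarrow> f \<in> carrier L \<rightarrow> carrier L' \<and> f \<in> extensional (carrier L)"
  by (auto simp: lq_hom_def PiE_def)

lemma lq_hom_closed: "f \<in> lq_hom L L' \<Longrightarrow> a \<in> carrier L \<Longrightarrow> f a \<in> carrier L'"
  by (auto simp: lq_hom_def)

lemma lq_hom_mult:
  "f \<in> lq_hom L L' \<Longrightarrow> a \<in> carrier L \<Longrightarrow> b \<in> carrier L \<Longrightarrow> f (a \<cdot>\<^bsub>L\<^esub> b) = f a \<cdot>\<^bsub>L'\<^esub> f b"
  by (simp add: lq_hom_def)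

context
  fixes L :: "'a left_qg"
  assumes lq: "left_quasigroup L"
begin

lemma mult_closed [simp]: "u \<in> carrier L \<Longrightarrow> v \<in> carrier L \<Longrightarrow> u \<cdot>\<^bsub>L\<^esub> v \<in> carrier L"
proof -
  have "mult L \<in> carrier L \<rightarrow>\<^sub>E carrier L \<rightarrow>\<^sub>E carrier L"
    using lq by (simp add: left_quasigroup_def)
  then show "u \<in> carrier L \<Longrightarrow> v \<in> carrier L \<Longrightarrow> u \<cdot>\<^bsub>L\<^esub> v \<in> carrier L"
    by (blast dest: PiE_mem)
qed

lemma ldiv_closed_mult:
  assumes "u \<in> carrier L" "w \<in> carrier L"
  shows "ldiv L u w \<in> carrier L \<and> u \<cdot>\<^bsub>L\<^esub> ldiv L u w = w"
proof -
  have "\<exists>!v. v \<in> carrier L \<and> u \<cdot>\<^bsub>L\<^esub> v = w"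
    using lq assms by (simp add: left_quasigroup_def)
  then show ?thesis
    unfolding ldiv_def by (rule theI')
qed

lemma ldiv_closed [simp]: "u \<in> carrier L \<Longrightarrow> w \<in> carrier L \<Longrightarrow> ldiv L u w \<in> carrier L"
  and mult_ldiv [simp]: "u \<in> carrier L \<Longrightarrow> w \<in> carrier L \<Longrightarrow> u \<cdot>\<^bsub>L\<^esub> ldiv L u w = w"
  by (simp_all add: ldiv_closed_mult)

lemma mult_left_cancel:
  assumes "u \<in> carrier L" "v \<in> carrier L" "w \<in> carrier L"
  shows "u \<cdot>\<^bsub>L\<^esub> v = u \<cdot>\<^bsub>L\<^esub> w \<longleftrightarrow> v = w"
proof -
  have "\<exists>!x. x \<in> carrier L \<and> u \<cdot>\<^bsub>L\<^esub> x = u \<cdot>\<^bsub>L\<^esub> w"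
    using lq assms by (simp add: left_quasigroup_def)
  then obtain x where "\<forall>y. y \<in> carrier L \<and> u \<cdot>\<^bsub>L\<^esub> y = u \<cdot>\<^bsub>L\<^esub> w \<longrightarrow> y = x"
    by (rule ex1E)
  with spec[OF this, of v] spec[OF this, of w] assms show ?thesis
    by auto
qed

lemma ldiv_mult [simp]: "u \<in> carrier L \<Longrightarrow> v \<in> carrier L \<Longrightarrow> ldiv L u (u \<cdot>\<^bsub>L\<^esub> v) = v"
  using mult_left_cancel[of u "ldiv L u (u \<cdot>\<^bsub>L\<^esub> v)" v] by simp

lemma ldiv_left_cancel [simp]:
  assumes "u \<in> carrier L" "v \<in> carrier L" "w \<in> carrier L"
  shows "ldiv L u v = ldiv L u w \<longleftrightarrow> v = w"
  by (metis mult_ldiv[OF assms(1,2)] mult_ldiv[OF assms(1,3)])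

text \<open>
  The change of coordinates from steps to vertices: since \<open>u \<mapsto> a \<cdot> u\<close> is a bijection of \<open>L\<close>, a
  quantifier over the step \<open>u\<close> is a quantifier over the vertex \<open>b = a \<cdot> u\<close>. The variants below
  treat three steps with one common source, and two or three consecutive steps of a path.
\<close>

lemma all_steps:
  assumes "a \<in> carrier L"
  shows "(\<forall>u\<in>carrier L. P u) \<longleftrightarrow> (\<forall>b\<in>carrier L. P (ldiv L a b))"
proof
  assume steps: "\<forall>b\<in>carrier L. P (ldiv L a b)"
  show "\<forall>u\<in>carrier L. P u"
  proof
    fix u assume "u \<in> carrier L"
    then show "P u"
      using assms steps[rule_format, of "a \<cdot>\<^bsub>L\<^esub> u"] by simp
  qed
qed (use assms in simp)

lemma all_steps3:
  assumes "a \<in> carrier L"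
  shows "(\<forall>u\<in>carrier L. \<forall>v\<in>carrier L. \<forall>w\<in>carrier L. P u v w) \<longleftrightarrow>
    (\<forall>b\<in>carrier L. \<forall>c\<in>carrier L. \<forall>d\<in>carrier L. P (ldiv L a b) (ldiv L a c) (ldiv L a d))"
proof -
  have "(\<forall>v\<in>carrier L. \<forall>w\<in>carrier L. Q v w) \<longleftrightarrow>
      (\<forall>c\<in>carrier L. \<forall>d\<in>carrier L. Q (ldiv L a c) (ldiv L a d))" for Q
    unfolding all_steps[OF assms, of "\<lambda>v. \<forall>w\<in>carrier L. Q v w"]
    by (rule ball_cong[OF refl], rule all_steps[OF assms])
  then show ?thesis
    unfolding all_steps[OF assms, of "\<lambda>u. \<forall>v\<in>carrier L. \<forall>w\<in>carrier L. P u v w"]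
    by (rule ball_cong[OF refl])
qed

lemma all_paths2:
  assumes "a \<in> carrier L"
  shows "(\<forall>u\<in>carrier L. \<forall>v\<in>carrier L. P u v) \<longleftrightarrow>
    (\<forall>b\<in>carrier L. \<forall>c\<in>carrier L. P (ldiv L a b) (ldiv L b c))"
  unfolding all_steps[OF assms, of "\<lambda>u. \<forall>v\<in>carrier L. P u v"]
  by (rule ball_cong[OF refl], rule all_steps)

lemma all_paths3:
  assumes "a \<in> carrier L"
  shows "(\<forall>u\<in>carrier L. \<forall>v\<in>carrier L. \<forall>w\<in>carrier L. P u v w) \<longleftrightarrow>
    (\<forall>b\<in>carrier L. \<forall>c\<in>carrier L. \<forall>d\<in>carrier L. P (ldiv L a b) (ldiv L b c) (ldiv L c d))"
  unfolding all_steps[OF assms, of "\<lambda>u. \<forall>v\<in>carrier L. \<forall>w\<in>carrier L. P u v w"]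
  by (rule ball_cong[OF refl], rule all_paths2)

end

lemma lq_hom_ldiv:
  assumes L: "left_quasigroup L" and L': "left_quasigroup L'" and f: "f \<in> lq_hom L L'"
    and "a \<in> carrier L" "b \<in> carrier L"
  shows "f (ldiv L a b) = ldiv L' (f a) (f b)"
proof -
  have "f b = f a \<cdot>\<^bsub>L'\<^esub> f (ldiv L a b)"
    using assms by (simp flip: lq_hom_mult[OF f])
  then show ?thesis
    using assms by (simp add: lq_hom_closed)
qed

lemma lq_hom_compose:
  assumes "left_quasigroup L" "f \<in> lq_hom L L'" "g \<in> lq_hom L' L''"
  shows "compose (carrier L) g f \<in> lq_hom L L''"
  using assms(1) lq_hom_closed[OF assms(2)] lq_hom_closed[OF assms(3)]
    lq_hom_mult[OF assms(2)] lq_hom_mult[OF assms(3)]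
  by (simp add: lq_hom_def compose_def)

lemma category_cat_T: "category cat_T"
  unfolding category_def
proof (intro conjI ballI, goal_cases)
  case (1 U)
  then show ?case
    by (auto simp: cat_T_def lq_hom_def)
next
  case (2 U V W f g)
  obtain L m L' m' L'' m'' where UVW: "U = (L, m)" "V = (L', m')" "W = (L'', m'')"
    by (metis surj_pair)
  then show ?case
    using 2 lq_hom_compose[of L f L' g L''] lq_hom_closed[of f L L']
    by (simp add: cat_T_def compose_def)
next
  case (3 U V f)
  then have "f \<in> lq_hom (fst U) (fst V)"
    by (simp add: cat_T_def case_prod_unfold)
  from compose_Id[of f, OF conjunct1 conjunct2, OF lq_hom_maps lq_hom_maps, OF this this]
  show ?case
    by (simp add: cat_T_def case_prod_unfold id_def)
next
  case (4 U V f)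
  then have "f \<in> lq_hom (fst U) (fst V)"
    by (simp add: cat_T_def case_prod_unfold)
  from Id_compose[of f, OF conjunct1 conjunct2, OF lq_hom_maps lq_hom_maps, OF this this]
  show ?case
    by (simp add: cat_T_def case_prod_unfold id_def)
next
  case (5 T U V W f g h)
  then have "f \<in> lq_hom (fst T) (fst U)"
    by (simp add: cat_T_def case_prod_unfold)
  then have "f \<in> carrier (fst T) \<rightarrow> carrier (fst U)"
    by (simp add: lq_hom_maps)
  from compose_assoc[OF this, of h g] show ?case
    by (simp add: cat_T_def case_prod_unfold)
qed

section \<open>Ternary operations and dynamical Yang-Baxter maps\<close>

text \<open>
  The map that replaces the path \<open>l, b, c\<close> by \<open>l, x, c\<close>. The second component of the value is the
  first step of the new path.
\<close>

definition dyn_of ::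
  "'a left_qg \<Rightarrow> ('a \<Rightarrow> 'a \<Rightarrow> 'a \<Rightarrow> 'a) \<Rightarrow> 'a \<Rightarrow> 'a \<times> 'a \<Rightarrow> 'a \<times> 'a" where
  "dyn_of L m = (\<lambda>l\<in>carrier L. \<lambda>p\<in>carrier L \<times> carrier L.
     let b = l \<cdot>\<^bsub>L\<^esub> fst p; c = b \<cdot>\<^bsub>L\<^esub> snd p; x = m l b c in (ldiv L x c, ldiv L l x))"

text \<open>
  The middle vertex of the new path, read off from its first step alone; for maps that keep the
  endpoints of paths this inverts \<open>dyn_of\<close>.
\<close>

definition ternary_of :: "'a left_qg \<Rightarrow> ('a \<Rightarrow> 'a \<times> 'a \<Rightarrow> 'a \<times> 'a) \<Rightarrow> 'a \<Rightarrow> 'a \<Rightarrow> 'a \<Rightarrow> 'a" where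
  "ternary_of L R = (\<lambda>a\<in>carrier L. \<lambda>b\<in>carrier L. \<lambda>c\<in>carrier L.
     a \<cdot>\<^bsub>L\<^esub> xi R a (ldiv L a b) (ldiv L b c))"

context
  fixes L :: "'a left_qg" and m :: "'a \<Rightarrow> 'a \<Rightarrow> 'a \<Rightarrow> 'a"
  assumes lq: "left_quasigroup L" and m: "m \<in> ternary_ops (carrier L)"
begin

text \<open>
  The values are again quotients of consecutive vertices, so with all steps written as quotients these
  rules evaluate iterated applications of \<open>dyn_of L m\<close> by rewriting.
\<close>

lemma dyn_of_step [simp]:
  assumes "a \<in> carrier L" "b \<in> carrier L" "c \<in> carrier L"
  shows "dyn_of L m a (ldiv L a b, ldiv L b c) = (ldiv L (m a b c) c, ldiv L a (m a b c))"
  using assms lq by (simp add: dyn_of_def Let_def)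

lemma xi_dyn_of [simp]:
  "a \<in> carrier L \<Longrightarrow> b \<in> carrier L \<Longrightarrow> c \<in> carrier L \<Longrightarrow>
   xi (dyn_of L m) a (ldiv L a b) (ldiv L b c) = ldiv L a (m a b c)"
  by (simp add: xi_def)

lemma eta_dyn_of [simp]:
  "a \<in> carrier L \<Longrightarrow> b \<in> carrier L \<Longrightarrow> c \<in> carrier L \<Longrightarrow>
   eta (dyn_of L m) a (ldiv L b c) (ldiv L a b) = ldiv L (m a b c) c"
  by (simp add: eta_def)

lemma dyn_of_maps: "dyn_of L m \<in> carrier L \<rightarrow>\<^sub>E carrier L \<times> carrier L \<rightarrow>\<^sub>E carrier L \<times> carrier L"
  using lq m by (simp add: dyn_of_def Let_def mem_Times_iff)

lemma ternary_of_dyn_of: "ternary_of L (dyn_of L m) = m"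
  using lq m by (intro ternary_ops_ext[OF _ m]) (simp_all add: ternary_of_def)

lemma dyn_of_endpoint:
  assumes "l \<in> carrier L" "u \<in> carrier L" "v \<in> carrier L"
  shows "(l \<cdot>\<^bsub>L\<^esub> xi (dyn_of L m) l u v) \<cdot>\<^bsub>L\<^esub> eta (dyn_of L m) l v u = (l \<cdot>\<^bsub>L\<^esub> u) \<cdot>\<^bsub>L\<^esub> v"
  using assms lq m by (simp add: xi_def eta_def dyn_of_def Let_def)

text \<open>
  Starting from the path \<open>a, b, c, d\<close>, the left-hand side ends in the path with inner vertices
  \<open>m a (m a b c) (m (m a b c) c d)\<close> and \<open>m (m a b c) c d\<close>, the right-hand side in the path with inner
  vertices \<open>m a b (m b c d)\<close> and \<open>m (m a b (m b c d)) (m b c d) d\<close>. A path is determined by its start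
  and its steps, so the equation compares these vertices one by one.
\<close>

lemma dyn_of_yang_baxter:
  "dynamical_YB_map (carrier L) (carrier L) (mult L) (dyn_of L m) \<longleftrightarrow> yb_identities (carrier L) m"
proof -
  let ?T = "carrier L"
  let ?YB = "\<lambda>a u. (on23 (dyn_of L m a) \<circ> (\<lambda>(u1, u2, u3). on13 (dyn_of L m (a \<cdot>\<^bsub>L\<^esub> u2)) (u1, u2, u3))
           \<circ> on12 (dyn_of L m a)) u =
        ((\<lambda>(u1, u2, u3). on12 (dyn_of L m (a \<cdot>\<^bsub>L\<^esub> u3)) (u1, u2, u3)) \<circ> on13 (dyn_of L m a) \<circ>
           (\<lambda>(u1, u2, u3). on23 (dyn_of L m (a \<cdot>\<^bsub>L\<^esub> u1)) (u1, u2, u3))) u"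
  have "(\<forall>u\<in>?T \<times> ?T \<times> ?T. ?YB a u) \<longleftrightarrow> (\<forall>b\<in>?T. \<forall>c\<in>?T. \<forall>d\<in>?T.
      m a (m a b c) (m (m a b c) c d) = m a b (m b c d) \<and>
      m (m a b c) c d = m (m a b (m b c d)) (m b c d) d)"
    if a: "a \<in> ?T" for a
  proof -
    have "(\<forall>u\<in>?T \<times> ?T \<times> ?T. ?YB a u) \<longleftrightarrow> (\<forall>u\<in>?T. \<forall>v\<in>?T. \<forall>w\<in>?T. ?YB a (u, v, w))"
      by blast
    also have "\<dots> \<longleftrightarrow> (\<forall>b\<in>?T. \<forall>c\<in>?T. \<forall>d\<in>?T. ?YB a (ldiv L a b, ldiv L b c, ldiv L c d))"
      by (rule all_paths3[OF lq a])
    also have "\<dots> \<longleftrightarrow> (\<forall>b\<in>?T. \<forall>c\<in>?T. \<forall>d\<in>?T.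
        m a (m a b c) (m (m a b c) c d) = m a b (m b c d) \<and>
        m (m a b c) c d = m (m a b (m b c d)) (m b c d) d)"
      using a lq m by (intro ball_cong refl) auto
    finally show ?thesis .
  qed
  then have "(\<forall>a\<in>?T. \<forall>u\<in>?T \<times> ?T \<times> ?T. ?YB a u) \<longleftrightarrow> yb_identities ?T m"
    by (simp add: yb_identities_def)
  moreover have "dyn_of L m \<in> ?T \<rightarrow> ?T \<times> ?T \<rightarrow> ?T \<times> ?T"
    using dyn_of_maps by (simp add: PiE_def Pi_def)
  moreover have "?T \<noteq> {}"
    using lq by (simp add: left_quasigroup_def)
  ultimately show ?thesis
    using lq unfolding dynamical_YB_map_def by simp
qed

text \<open>
  Evaluated on the path \<open>a, b, c, d\<close> with steps \<open>u\<close>, \<open>v\<close>, \<open>w\<close>, the two axioms become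
  \<open>m (m a b c) c d = m a b d\<close> and \<open>m a b b = a\<close>.
\<close>

lemma dyn_of_identities2:
  "(\<forall>l\<in>carrier L. \<forall>u\<in>carrier L. \<forall>v\<in>carrier L. \<forall>w\<in>carrier L.
       (l \<cdot>\<^bsub>L\<^esub> xi (dyn_of L m) l u v) \<cdot>\<^bsub>L\<^esub>
           xi (dyn_of L m) (l \<cdot>\<^bsub>L\<^esub> xi (dyn_of L m) l u v) (eta (dyn_of L m) l v u) w
         = l \<cdot>\<^bsub>L\<^esub> xi (dyn_of L m) l u (ldiv L (l \<cdot>\<^bsub>L\<^esub> u) (((l \<cdot>\<^bsub>L\<^esub> u) \<cdot>\<^bsub>L\<^esub> v) \<cdot>\<^bsub>L\<^esub> w)) \<and>
       xi (dyn_of L m) l u (ldiv L (l \<cdot>\<^bsub>L\<^esub> u) (l \<cdot>\<^bsub>L\<^esub> u)) = ldiv L l l)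
   \<longleftrightarrow> identities2 (carrier L) m" (is "(\<forall>l\<in>_. \<forall>u\<in>_. \<forall>v\<in>_. \<forall>w\<in>_. ?P l u v w) \<longleftrightarrow> _")
proof -
  have "(\<forall>u\<in>carrier L. \<forall>v\<in>carrier L. \<forall>w\<in>carrier L. ?P a u v w) \<longleftrightarrow>
      (\<forall>b\<in>carrier L. \<forall>c\<in>carrier L. \<forall>d\<in>carrier L. m (m a b c) c d = m a b d \<and> m a b b = a)"
    if a: "a \<in> carrier L" for a
  proof -
    have "(\<forall>u\<in>carrier L. \<forall>v\<in>carrier L. \<forall>w\<in>carrier L. ?P a u v w) \<longleftrightarrow>
        (\<forall>b\<in>carrier L. \<forall>c\<in>carrier L. \<forall>d\<in>carrier L. ?P a (ldiv L a b) (ldiv L b c) (ldiv L c d))"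
      by (rule all_paths3[OF lq a])
    also have "\<dots> \<longleftrightarrow> (\<forall>b\<in>carrier L. \<forall>c\<in>carrier L. \<forall>d\<in>carrier L.
        m (m a b c) c d = m a b d \<and> m a b b = a)"
      using a lq m by (intro ball_cong refl) simp
    finally show ?thesis .
  qed
  then show ?thesis
    by (simp add: identities2_def)
qed

text \<open>
  Here \<open>u\<close>, \<open>v\<close>, \<open>w\<close> are three steps from the same vertex \<open>a\<close>, leading to \<open>d\<close>, \<open>b\<close>, \<open>c\<close>. The first
  axiom becomes \<open>m a b (m d a c) = m d b c\<close>, which is the identity
  \<open>m a b c = m d b (m a d c)\<close> with \<open>a\<close> and \<open>d\<close> exchanged.
\<close>

lemma dyn_of_identities3:
  "(\<forall>l\<in>carrier L. \<forall>u\<in>carrier L. \<forall>v\<in>carrier L. \<forall>w\<in>carrier L.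
       l \<cdot>\<^bsub>L\<^esub> xi (dyn_of L m) l v (ldiv L (l \<cdot>\<^bsub>L\<^esub> v)
           ((l \<cdot>\<^bsub>L\<^esub> u) \<cdot>\<^bsub>L\<^esub> xi (dyn_of L m) (l \<cdot>\<^bsub>L\<^esub> u) (ldiv L (l \<cdot>\<^bsub>L\<^esub> u) l) w))
         = (l \<cdot>\<^bsub>L\<^esub> u) \<cdot>\<^bsub>L\<^esub> xi (dyn_of L m) (l \<cdot>\<^bsub>L\<^esub> u) (ldiv L (l \<cdot>\<^bsub>L\<^esub> u) (l \<cdot>\<^bsub>L\<^esub> v))
             (ldiv L (l \<cdot>\<^bsub>L\<^esub> v) (l \<cdot>\<^bsub>L\<^esub> w)) \<and>
       xi (dyn_of L m) l (ldiv L l l) w = w)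
   \<longleftrightarrow> identities3 (carrier L) m" (is "(\<forall>l\<in>_. \<forall>u\<in>_. \<forall>v\<in>_. \<forall>w\<in>_. ?P l u v w) \<longleftrightarrow> _")
proof -
  have "(\<forall>u\<in>carrier L. \<forall>v\<in>carrier L. \<forall>w\<in>carrier L. ?P a u v w) \<longleftrightarrow>
      (\<forall>d\<in>carrier L. \<forall>b\<in>carrier L. \<forall>c\<in>carrier L. m a b (m d a c) = m d b c \<and> m a a c = c)"
    if a: "a \<in> carrier L" for a
  proof -
    have "(\<forall>u\<in>carrier L. \<forall>v\<in>carrier L. \<forall>w\<in>carrier L. ?P a u v w) \<longleftrightarrow>
        (\<forall>d\<in>carrier L. \<forall>b\<in>carrier L. \<forall>c\<in>carrier L. ?P a (ldiv L a d) (ldiv L a b) (ldiv L a c))"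
      by (rule all_steps3[OF lq a])
    also have "\<dots> \<longleftrightarrow> (\<forall>d\<in>carrier L. \<forall>b\<in>carrier L. \<forall>c\<in>carrier L.
        m a b (m d a c) = m d b c \<and> m a a c = c)"
      using a lq m by (intro ball_cong refl) simp
    finally show ?thesis .
  qed
  moreover have "identities3 (carrier L) m \<longleftrightarrow>
      (\<forall>a\<in>carrier L. \<forall>d\<in>carrier L. \<forall>b\<in>carrier L. \<forall>c\<in>carrier L.
        m a b (m d a c) = m d b c \<and> m a a c = c)"
    unfolding identities3_def by (intro iffI ballI conjI) metis+
  ultimately show ?thesis
    by simp
qed

end

text \<open>
  By the endpoint condition \<open>\<xi>\<close> determines \<open>\<eta>\<close>, since \<open>\<eta>\<^sub>\<lambda>(v)(u)\<close> has to be the only step from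
  \<open>\<lambda> \<xi>\<^sub>\<lambda>(u)(v)\<close> to \<open>(\<lambda>u)v\<close>. So \<open>R\<close> can be recovered from its middle vertices.
\<close>

lemma dyn_of_ternary_of:
  assumes lq: "left_quasigroup L"
    and R: "R \<in> carrier L \<rightarrow>\<^sub>E carrier L \<times> carrier L \<rightarrow>\<^sub>E carrier L \<times> carrier L"
    and inv: "\<forall>l\<in>carrier L. \<forall>u\<in>carrier L. \<forall>v\<in>carrier L.
          (l \<cdot>\<^bsub>L\<^esub> xi R l u v) \<cdot>\<^bsub>L\<^esub> eta R l v u = (l \<cdot>\<^bsub>L\<^esub> u) \<cdot>\<^bsub>L\<^esub> v"
  shows "ternary_of L R \<in> ternary_ops (carrier L)" "dyn_of L (ternary_of L R) = R"
proof -
  have Rl: "R l \<in> carrier L \<times> carrier L \<rightarrow>\<^sub>E carrier L \<times> carrier L" if "l \<in> carrier L" for l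
    using R that by (rule PiE_mem)
  have closed: "R l p \<in> carrier L \<times> carrier L"
    if "l \<in> carrier L" "p \<in> carrier L \<times> carrier L" for l p
    using PiE_mem[OF Rl] that by blast
  have eta_xi: "eta R l v u \<in> carrier L" "xi R l u v \<in> carrier L"
    if "l \<in> carrier L" "u \<in> carrier L" "v \<in> carrier L" for l u v
    using closed[of l "(u, v)"] that by (auto simp: eta_def xi_def mem_Times_iff)
  show m: "ternary_of L R \<in> ternary_ops (carrier L)"
    using lq by (simp add: ternary_of_def eta_xi)
  show "dyn_of L (ternary_of L R) = R"
  proof (rule PiE_ext[OF dyn_of_maps[OF lq m] R])
    fix l assume l: "l \<in> carrier L"
    show "dyn_of L (ternary_of L R) l = R l"
    proof (rule PiE_ext[OF PiE_mem[OF dyn_of_maps[OF lq m] l] Rl[OF l]])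
      fix p assume "p \<in> carrier L \<times> carrier L"
      then obtain u v where p: "p = (u, v)" and uv: "u \<in> carrier L" "v \<in> carrier L"
        by auto
      let ?x = "l \<cdot>\<^bsub>L\<^esub> xi R l u v"
      have "dyn_of L (ternary_of L R) l p = (ldiv L ?x ((l \<cdot>\<^bsub>L\<^esub> u) \<cdot>\<^bsub>L\<^esub> v), ldiv L l ?x)"
        using lq l uv by (simp add: p dyn_of_def ternary_of_def Let_def)
      also have "\<dots> = (ldiv L ?x (?x \<cdot>\<^bsub>L\<^esub> eta R l v u), xi R l u v)"
        using lq l uv inv eta_xi by simp
      also have "\<dots> = (eta R l v u, xi R l u v)"
        using lq l uv eta_xi by simp
      finally show "dyn_of L (ternary_of L R) l p = R l p"
        by (simp add: p eta_def xi_def)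
    qed
  qed
qed

text \<open>
  Homomorphisms of left quasigroups preserve quotients, so \<open>f\<close> maps the path with steps \<open>(u, v)\<close> to the
  path with steps \<open>(f u, f v)\<close>; compatibility with the maps \<open>R\<close> only concerns the new middle vertex.
\<close>

lemma dyn_of_hom_iff:
  assumes L: "left_quasigroup L" "m \<in> ternary_ops (carrier L)"
    and L': "left_quasigroup L'" "m' \<in> ternary_ops (carrier L')"
    and f: "f \<in> lq_hom L L'"
  shows "(\<forall>l\<in>carrier L. \<forall>p\<in>carrier L \<times> carrier L.
        dyn_of L' m' (f l) (map_prod f f p) = map_prod f f (dyn_of L m l p)) \<longleftrightarrow>
     (\<forall>a\<in>carrier L. \<forall>b\<in>carrier L. \<forall>c\<in>carrier L. f (m a b c) = m' (f a) (f b) (f c))"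
    (is "(\<forall>l\<in>_. \<forall>p\<in>_. ?P l p) \<longleftrightarrow> _")
proof -
  note [simp] = lq_hom_ldiv[OF L(1) L'(1) f] lq_hom_closed[OF f]
  have "(\<forall>p\<in>carrier L \<times> carrier L. ?P a p) \<longleftrightarrow>
      (\<forall>b\<in>carrier L. \<forall>c\<in>carrier L. f (m a b c) = m' (f a) (f b) (f c))"
    if a: "a \<in> carrier L" for a
  proof -
    have "(\<forall>p\<in>carrier L \<times> carrier L. ?P a p) \<longleftrightarrow> (\<forall>u\<in>carrier L. \<forall>v\<in>carrier L. ?P a (u, v))"
      by auto
    also have "\<dots> \<longleftrightarrow> (\<forall>b\<in>carrier L. \<forall>c\<in>carrier L. ?P a (ldiv L a b, ldiv L b c))"
      by (rule all_paths2[OF L(1) a])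
    also have "\<dots> \<longleftrightarrow> (\<forall>b\<in>carrier L. \<forall>c\<in>carrier L. f (m a b c) = m' (f a) (f b) (f c))"
      using a L L' by (auto simp: eq_commute)
    finally show ?thesis .
  qed
  then show ?thesis
    by simp
qed

lemma relabels_T_D: "relabels (\<lambda>(L, m). (L, dyn_of L m)) cat_T (cat_D :: ('a dyn, 'a \<Rightarrow> 'a) cat)"
proof -
  let ?F = "\<lambda>(L :: 'a left_qg, m). (L, dyn_of L m)" and ?G = "\<lambda>(L :: 'a left_qg, R). (L, ternary_of L R)"
  have "bij_betw ?F (Obj cat_T) (Obj cat_D)"
  proof (rule bij_betw_byWitness[where f' = ?G])
    show "?F ` Obj cat_T \<subseteq> Obj cat_D"
    proof clarify
      fix L :: "'a left_qg" and m
      assume "(L, m) \<in> Obj cat_T"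
      then show "(L, dyn_of L m) \<in> Obj cat_D"
        using dyn_of_maps[of L m] dyn_of_endpoint[of L m] dyn_of_yang_baxter[of L m]
        by (simp add: cat_T_def cat_D_def)
    qed
    show "?G ` Obj cat_D \<subseteq> Obj cat_T"
    proof clarify
      fix L :: "'a left_qg" and R
      assume "(L, R) \<in> Obj cat_D"
      then show "(L, ternary_of L R) \<in> Obj cat_T"
        using dyn_of_ternary_of[of L R] dyn_of_yang_baxter[of L "ternary_of L R"]
        by (simp add: cat_T_def cat_D_def)
    qed
    show "\<forall>x\<in>Obj cat_T. ?G (?F x) = x"
      by (auto simp: cat_T_def ternary_of_dyn_of)
    show "\<forall>x\<in>Obj cat_D. ?F (?G x) = x"
      by (auto simp: cat_D_def dyn_of_ternary_of)
  qed
  moreover have "Hom cat_D (L, dyn_of L m) (L', dyn_of L' m') = Hom cat_T (L, m) (L', m')"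
    if "(L, m) \<in> Obj cat_T" "(L', m') \<in> Obj cat_T" for L L' :: "'a left_qg" and m m'
    using that dyn_of_hom_iff[of L m L' m'] by (auto simp: cat_T_def cat_D_def)
  ultimately show ?thesis
    by (auto simp: relabels_def) (auto simp: cat_T_def cat_D_def)
qed

section \<open>Ternary operations and classes of triplets\<close>

definition pullback :: "'a triplet \<Rightarrow> 'a \<Rightarrow> 'a \<Rightarrow> 'a \<Rightarrow> 'a" where
  "pullback = (\<lambda>(L, M, \<pi>). \<lambda>a\<in>carrier L. \<lambda>b\<in>carrier L. \<lambda>c\<in>carrier L.
     inv_into (carrier L) \<pi> (tern M (\<pi> a) (\<pi> b) (\<pi> c)))"

definition triplets_over :: "'a left_qg \<times> ('a \<Rightarrow> 'a \<Rightarrow> 'a \<Rightarrow> 'a) \<Rightarrow> 'a triplet set" where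
  "triplets_over = (\<lambda>(L, m). {t \<in> LMB. fst t = L \<and> pullback t = m})"

context
  fixes L :: "'a left_qg" and M :: "'a ternary" and \<pi> :: "'a \<Rightarrow> 'a"
  assumes M: "ternary_system M" and bij: "bij_betw \<pi> (carrier L) (tcarrier M)"
begin

lemma tcarrier_eq: "tcarrier M = \<pi> ` carrier L"
  using bij by (simp add: bij_betw_def)

lemma tern_closed: "a \<in> tcarrier M \<Longrightarrow> b \<in> tcarrier M \<Longrightarrow> c \<in> tcarrier M \<Longrightarrow> tern M a b c \<in> tcarrier M"
  using M by (simp add: ternary_system_def flip: ternary_ops_def)

lemma pullback_ternary_ops: "pullback (L, M, \<pi>) \<in> ternary_ops (carrier L)"
  using tern_closed by (simp add: pullback_def tcarrier_eq inv_into_into)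

lemma tern_eq_pullback:
  "a \<in> carrier L \<Longrightarrow> b \<in> carrier L \<Longrightarrow> c \<in> carrier L \<Longrightarrow>
   tern M (\<pi> a) (\<pi> b) (\<pi> c) = \<pi> (pullback (L, M, \<pi>) a b c)"
  using tern_closed by (simp add: pullback_def tcarrier_eq f_inv_into_f)

lemma bij_eq_iff: "a \<in> carrier L \<Longrightarrow> b \<in> carrier L \<Longrightarrow> \<pi> a = \<pi> b \<longleftrightarrow> a = b"
  using bij by (auto simp: bij_betw_def inj_on_def)

lemma pullback_identities:
  "yb_identities (tcarrier M) (tern M) \<longleftrightarrow> yb_identities (carrier L) (pullback (L, M, \<pi>))"
  "identities2 (tcarrier M) (tern M) \<longleftrightarrow> identities2 (carrier L) (pullback (L, M, \<pi>))"
  "identities3 (tcarrier M) (tern M) \<longleftrightarrow> identities3 (carrier L) (pullback (L, M, \<pi>))"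
  unfolding yb_identities_def identities2_def identities3_def tcarrier_eq
  using pullback_ternary_ops by (simp_all add: tern_eq_pullback bij_eq_iff)

end

lemma LMB_iff:
  "(L, M, \<pi>) \<in> LMB \<longleftrightarrow> left_quasigroup L \<and> ternary_system M \<and>
     yb_identities (tcarrier M) (tern M) \<and>
     \<pi> \<in> extensional (carrier L) \<and> bij_betw \<pi> (carrier L) (tcarrier M)"
  by (simp add: LMB_def yb_identities_def)

text \<open>
  Used twice: with \<open>f\<close> the identity it describes the equivalence of triplets, and for general \<open>f\<close> it
  shows that the morphism condition does not depend on the representatives.
\<close>

lemma ternary_hom_iff_pullback:
  assumes t: "(L, M, \<pi>) \<in> LMB" and t': "(L', M', \<pi>') \<in> LMB"
    and f: "\<And>a. a \<in> carrier L \<Longrightarrow> f a \<in> carrier L'"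
  shows "ternary_hom M M' (\<pi>' \<circ> f \<circ> inv_into (carrier L) \<pi>) \<longleftrightarrow>
    (\<forall>a\<in>carrier L. \<forall>b\<in>carrier L. \<forall>c\<in>carrier L.
      f (pullback (L, M, \<pi>) a b c) = pullback (L', M', \<pi>') (f a) (f b) (f c))"
proof -
  have M: "ternary_system M" "bij_betw \<pi> (carrier L) (tcarrier M)"
    and M': "ternary_system M'" "bij_betw \<pi>' (carrier L') (tcarrier M')"
    using t t' by (simp_all add: LMB_iff)
  note [simp] = pullback_ternary_ops[OF M] pullback_ternary_ops[OF M'] f
    tern_eq_pullback[OF M] tern_eq_pullback[OF M'] bij_eq_iff[OF M']
    bij_betw_inv_into_left[OF M(2)] tcarrier_eq[OF M] tcarrier_eq[OF M']
  show ?thesis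
    by (auto simp: ternary_hom_def)
qed

lemma LMB_rel_iff:
  "(s, t) \<in> LMB_rel \<longleftrightarrow> s \<in> LMB \<and> t \<in> LMB \<and> fst s = fst t \<and> pullback s = pullback t"
proof -
  obtain L M \<pi> L' M' \<pi>' where st: "s = (L, M, \<pi>)" "t = (L', M', \<pi>')"
    by (metis prod_cases3)
  have "ternary_hom M M' (\<pi>' \<circ> inv_into (carrier L) \<pi>) \<longleftrightarrow> pullback s = pullback t"
    if "s \<in> LMB" "t \<in> LMB" "L = L'"
  proof -
    have ops: "pullback s \<in> ternary_ops (carrier L)" "pullback t \<in> ternary_ops (carrier L)"
      using that by (simp_all add: st LMB_iff pullback_ternary_ops)
    show ?thesis
      using that ternary_hom_iff_pullback[of L M \<pi> L' M' \<pi>' "\<lambda>x. x"] ternary_ops_ext[OF ops]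
      by (auto simp: st comp_def)
  qed
  then show ?thesis
    by (auto simp: LMB_rel_def st)
qed

lemma LMB_rel_class: "t \<in> LMB \<Longrightarrow> LMB_rel `` {t} = triplets_over (fst t, pullback t)"
  by (auto simp: LMB_rel_iff triplets_over_def)

lemma triplet_pullback_in_cat_T:
  assumes "t \<in> LMB"
  shows "(fst t, pullback t) \<in> Obj cat_T"
proof -
  obtain L M \<pi> where t: "t = (L, M, \<pi>)"
    by (metis prod_cases3)
  with assms show ?thesis
    using pullback_ternary_ops[of M \<pi> L] pullback_identities(1)[of M \<pi> L]
    by (simp add: LMB_iff cat_T_def)
qed

text \<open>
  Every pair \<open>(L, m)\<close> has a canonical triplet over it, hence no class \<open>triplets_over (L, m)\<close> is empty.
  The class therefore determines \<open>L\<close> and \<open>m\<close>, and quantifiers over its representatives are not vacuous.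
\<close>

lemma identity_triplet:
  assumes "(L, m) \<in> Obj cat_T"
  shows "(L, \<lparr>tcarrier = carrier L, tern = m\<rparr>, restrict id (carrier L)) \<in> triplets_over (L, m)"
proof -
  let ?M = "\<lparr>tcarrier = carrier L, tern = m\<rparr>" and ?\<pi> = "restrict id (carrier L)"
  have L: "left_quasigroup L" "m \<in> ternary_ops (carrier L)" "yb_identities (carrier L) m"
    using assms by (simp_all add: cat_T_def)
  have M: "ternary_system ?M"
    using L by (simp add: ternary_system_def ternary_ops_def left_quasigroup_def)
  have bij: "bij_betw ?\<pi> (carrier L) (tcarrier ?M)"
    by (auto simp: bij_betw_def inj_on_def)
  have "pullback (L, ?M, ?\<pi>) = m"
  proof (rule ternary_ops_ext[OF pullback_ternary_ops[OF M bij] L(2)])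
    fix a b c assume "a \<in> carrier L" "b \<in> carrier L" "c \<in> carrier L"
    then show "pullback (L, ?M, ?\<pi>) a b c = m a b c"
      using tern_eq_pullback[OF M bij, of a b c] pullback_ternary_ops[OF M bij] by simp
  qed
  with L M bij show ?thesis
    by (simp add: triplets_over_def LMB_iff)
qed

lemma lq_of_triplets_over:
  assumes "(L, m) \<in> Obj cat_T"
  shows "lq_of (triplets_over (L, m)) = L"
  unfolding lq_of_def
proof (rule the_equality)
  show "\<exists>M \<pi>. (L, M, \<pi>) \<in> triplets_over (L, m)"
    using identity_triplet[OF assms] by blast
qed (auto simp: triplets_over_def)

lemma triplets_over_identities:
  assumes "(L, m) \<in> Obj cat_T"
  shows "(\<exists>L' M \<pi>. (L', M, \<pi>) \<in> triplets_over (L, m) \<and> identities2 (tcarrier M) (tern M)) \<longleftrightarrow>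
      identities2 (carrier L) m"
    and "(\<exists>L' M \<pi>. (L', M, \<pi>) \<in> triplets_over (L, m) \<and> identities3 (tcarrier M) (tern M)) \<longleftrightarrow>
      identities3 (carrier L) m"
proof -
  have rep: "identities2 (tcarrier M) (tern M) \<longleftrightarrow> identities2 (carrier L) m"
    "identities3 (tcarrier M) (tern M) \<longleftrightarrow> identities3 (carrier L) m"
    if "(L', M, \<pi>) \<in> triplets_over (L, m)" for L' M \<pi>
    using pullback_identities(2,3)[of M \<pi> L] that by (auto simp: triplets_over_def LMB_iff)
  show "(\<exists>L' M \<pi>. (L', M, \<pi>) \<in> triplets_over (L, m) \<and> identities2 (tcarrier M) (tern M)) \<longleftrightarrow>
      identities2 (carrier L) m"
    using rep(1) identity_triplet[OF assms] by blast
  show "(\<exists>L' M \<pi>. (L', M, \<pi>) \<in> triplets_over (L, m) \<and> identities3 (tcarrier M) (tern M)) \<longleftrightarrow>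
      identities3 (carrier L) m"
    using rep(2) identity_triplet[OF assms] by blast
qed

lemma relabels_T_A: "relabels triplets_over cat_T (cat_A :: ('a triplet set, 'a \<Rightarrow> 'a) cat)"
proof -
  have "bij_betw triplets_over (Obj cat_T) (Obj (cat_A :: ('a triplet set, 'a \<Rightarrow> 'a) cat))"
    unfolding bij_betw_def
  proof
    show "inj_on (triplets_over :: _ \<Rightarrow> 'a triplet set) (Obj cat_T)"
    proof (rule inj_onI)
      fix x y :: "'a left_qg \<times> ('a \<Rightarrow> 'a \<Rightarrow> 'a \<Rightarrow> 'a)"
      assume "x \<in> Obj cat_T" "triplets_over x = triplets_over y"
      then obtain t where "t \<in> triplets_over x" "t \<in> triplets_over y"
        using identity_triplet[of "fst x" "snd x"] by auto
      then show "x = y"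
        by (auto simp: triplets_over_def)
    qed
    show "triplets_over ` Obj cat_T = Obj (cat_A :: ('a triplet set, 'a \<Rightarrow> 'a) cat)"
    proof
      show "triplets_over ` Obj cat_T \<subseteq> Obj (cat_A :: ('a triplet set, 'a \<Rightarrow> 'a) cat)"
      proof clarify
        fix L :: "'a left_qg" and m
        assume "(L, m) \<in> Obj cat_T"
        then obtain t where "t \<in> triplets_over (L, m)"
          using identity_triplet by blast
        then have t: "t \<in> LMB" "fst t = L" "pullback t = m"
          by (auto simp: triplets_over_def)
        have "triplets_over (L, m) = LMB_rel `` {t}"
          using LMB_rel_class[OF t(1)] t by simp
        with t show "triplets_over (L, m) \<in> Obj cat_A"
          by (auto simp: cat_A_def intro: quotientI)
      qed
      show "Obj (cat_A :: ('a triplet set, 'a \<Rightarrow> 'a) cat) \<subseteq> triplets_over ` Obj cat_T"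
      proof
        fix V :: "'a triplet set"
        assume "V \<in> Obj cat_A"
        then obtain t where t: "t \<in> LMB" "V = LMB_rel `` {t}"
          by (auto simp: cat_A_def elim: quotientE)
        then show "V \<in> triplets_over ` Obj cat_T"
          using LMB_rel_class[OF t(1)] triplet_pullback_in_cat_T[OF t(1)] by auto
      qed
    qed
  qed
  moreover have "Hom cat_A (triplets_over (L, m)) (triplets_over (L', m')) = Hom cat_T (L, m) (L', m')"
    if x: "(L, m) \<in> Obj cat_T" and y: "(L', m') \<in> Obj cat_T"
    for L L' :: "'a left_qg" and m m'
  proof -
    have "(\<forall>M \<pi> M' \<pi>'. (L, M, \<pi>) \<in> triplets_over (L, m) \<longrightarrow>
           (L', M', \<pi>') \<in> triplets_over (L', m') \<longrightarrow>
           ternary_hom M M' (\<pi>' \<circ> f \<circ> inv_into (carrier L) \<pi>)) \<longleftrightarrow>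
        (\<forall>a\<in>carrier L. \<forall>b\<in>carrier L. \<forall>c\<in>carrier L. f (m a b c) = m' (f a) (f b) (f c))"
      (is "?all \<longleftrightarrow> ?hom")
      if f: "f \<in> lq_hom L L'" for f
    proof -
      have rep: "ternary_hom M M' (\<pi>' \<circ> f \<circ> inv_into (carrier L) \<pi>) \<longleftrightarrow> ?hom"
        if "(L, M, \<pi>) \<in> triplets_over (L, m)" "(L', M', \<pi>') \<in> triplets_over (L', m')"
        for M \<pi> M' \<pi>'
        using ternary_hom_iff_pullback[of L M \<pi> L' M' \<pi>' f] that lq_hom_closed[OF f]
        by (auto simp: triplets_over_def)
      then show ?thesis
        using identity_triplet[OF x] identity_triplet[OF y] by blast
    qed
    then show ?thesis
      by (simp add: cat_A_def cat_T_def lq_of_triplets_over[OF x] lq_of_triplets_over[OF y]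
          cong: conj_cong)
  qed
  moreover have "Id cat_A (triplets_over (L, m)) = Id cat_T (L, m)"
    and "Comp cat_A (triplets_over (L, m)) V W g f = Comp cat_T (L, m) V' W' g f"
    if "(L, m) \<in> Obj cat_T" for L :: "'a left_qg" and m V W V' W' g f
    using lq_of_triplets_over[OF that] by (simp_all add: cat_A_def cat_T_def)
  ultimately show ?thesis
    by (simp add: relabels_def split_paired_all)
qed

section \<open>The isomorphisms\<close>

lemma isomorphic_full_subcategories_A_D:
  fixes P :: "'a triplet set \<Rightarrow> bool"
  assumes "\<And>x. x \<in> Obj cat_T \<Longrightarrow> S x \<longleftrightarrow> P (triplets_over x)"
    and "\<And>L m. (L, m) \<in> Obj cat_T \<Longrightarrow> S (L, m) \<longleftrightarrow> Q (L, dyn_of L m)"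
  shows "isomorphic_categories (full_subcategory cat_A P) (full_subcategory cat_D Q)"
proof -
  have A: "relabels triplets_over (full_subcategory cat_T S) (full_subcategory cat_A P)"
    using relabels_T_A assms(1) by (rule relabels_full_subcategory)
  have D: "relabels (\<lambda>(L, m). (L, dyn_of L m)) (full_subcategory cat_T S) (full_subcategory cat_D Q)"
    using relabels_T_D by (rule relabels_full_subcategory) (auto simp: assms(2))
  show ?thesis
    using relabels_category[OF category_full_subcategory[OF category_cat_T] A]
      relabels_trans[OF relabels_inv[OF A] D]
    by (rule relabels_isomorphic)
qed

theorem proposition6p15:
  shows "isomorphic_categories
           (cat_A2 :: ('a triplet set, 'a \<Rightarrow> 'a) cat) (cat_D2 :: ('a dyn, 'a \<Rightarrow> 'a) cat) \<and>
         isomorphic_categories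
           (cat_A3 :: ('a triplet set, 'a \<Rightarrow> 'a) cat) (cat_D3 :: ('a dyn, 'a \<Rightarrow> 'a) cat)"
proof
  have obj: "left_quasigroup L" "m \<in> ternary_ops (carrier L)" if "(L, m) \<in> Obj cat_T"
    for L :: "'a left_qg" and m
    using that by (simp_all add: cat_T_def)
  show "isomorphic_categories
      (cat_A2 :: ('a triplet set, 'a \<Rightarrow> 'a) cat) (cat_D2 :: ('a dyn, 'a \<Rightarrow> 'a) cat)"
    unfolding cat_A2_def cat_D2_def
  proof (rule isomorphic_full_subcategories_A_D[where S = "\<lambda>(L, m). identities2 (carrier L) m"],
      goal_cases)
    case (1 x)
    then show ?case
      using triplets_over_identities(1)[of "fst x" "snd x"]
      by (simp add: identities2_def case_prod_unfold)
  next
    case (2 L m)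
    then show ?case
      using dyn_of_identities2[OF obj[OF 2]] by simp
  qed
  show "isomorphic_categories
      (cat_A3 :: ('a triplet set, 'a \<Rightarrow> 'a) cat) (cat_D3 :: ('a dyn, 'a \<Rightarrow> 'a) cat)"
    unfolding cat_A3_def cat_D3_def
  proof (rule isomorphic_full_subcategories_A_D[where S = "\<lambda>(L, m). identities3 (carrier L) m"],
      goal_cases)
    case (1 x)
    then show ?case
      using triplets_over_identities(2)[of "fst x" "snd x"]
      by (simp add: identities3_def case_prod_unfold)
  next
    case (2 L m)
    then show ?case
      using dyn_of_identities3[OF obj[OF 2]] by simp
  qed
qed

end
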